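(* Let $G$ be a finite abelian group, let $\Gamma=\operatorname{Cay}(G,S)$ be a strongly connected Cayley digraph, and let $\phi:G\to P$ be a surjective homomorphism onto a finite group $P$. Define $\overline\Gamma:=\operatorname{Cay}\left(P,\phi(S)\setminus\{0\}\right)$. Then $$ c_{1,\infty}(\Gamma)\le |\ker\phi|\; c_{1,\infty}(\overline\Gamma). $$ The same inequality holds with $c_{1,s}$ in place of $c_{1,\infty}$ for every finite integer $s\ge 1$, i.e. $c_{1,s}(\Gamma)\le|\ker\phi|\,c_{1,s}(\overline\Gamma)$.
   Context: Cayley digraphs: for a finite abelian group $G$ written additively and $S\subseteq G\setminus\{0\}$, $\operatorname{Cay}(G,S)$ is the digraph with vertex set $G$ and an arc $x\to x+g$ for every $x\in G$, $g\in S$. It is strongly connected if and only if $S$ generates $G$. The group $G$ is assumed nontrivial ($|G|\ge2$). The game on a finite digraph $\Gamma$ with speed-$1$ cops and a speed-$s$ robber: the cops choose their initial vertices first, then the robber chooses its initial vertex. Thereafter players alternate, the cops moving first in each round. On the cops' move each cop may remain where it is or move along one arc. On the robber's move, the robber may remain where it is or move along a directed path of length at most $s$ no vertex of which (including the terminal vertex) is occupied by a cop. A directed path is a vertex sequence without repetition whose consecutive vertices are joined by arcs in the forward direction; its length is its number of arcs. Capture occurs as soon as a cop and the robber occupy the same vertex. $c_{1,s}(\Gamma)$ is the least number of speed-$1$ cops that guarantee capture of a speed-$s$ robber. $c_{1,\infty}(\Gamma)$ is the corresponding number when the robber may traverse any finite cop-free directed path (of arbitrary length) in one turn. *)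

theory Defs
  imports
    "HOL-Algebra.Coset"
    "HOL-Library.Extended_Nat"
    "Graph_Theory.Digraph_Component"
    "Graph_Theory.Vertex_Walk"
begin

section \<open>Cayley digraphs\<close>

text \<open>Groups are written multiplicatively, as in HOL-Algebra: the arcs are
  \<open>x \<rightarrow> x \<otimes> g\<close>, and \<open>\<one>\<close> plays the role of the zero element.\<close>

definition Cay :: "('a, 'm) monoid_scheme \<Rightarrow> 'a set \<Rightarrow> 'a pair_pre_digraph" where
  "Cay G S = \<lparr> pverts = carrier G,
               parcs = {(x, x \<otimes>\<^bsub>G\<^esub> g) | x g. x \<in> carrier G \<and> g \<in> S} \<rparr>"

section \<open>The game with speed-1 cops and a speed-s robber\<close>

text \<open>With \<open>k\<close> cops, a placement is a function \<open>C :: nat \<Rightarrow> 'a\<close> of which only the values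
  at \<open>i < k\<close> matter. The speed \<open>s\<close> is an extended natural number, so that \<open>s = \<infinity>\<close>
  leaves the length of the robber's path unrestricted.\<close>

definition cop_move :: "('a, 'b) pre_digraph \<Rightarrow> nat \<Rightarrow> (nat \<Rightarrow> 'a) \<Rightarrow> (nat \<Rightarrow> 'a) \<Rightarrow> bool" where
  "cop_move \<Gamma> k C C' \<longleftrightarrow> (\<forall>i<k. C' i = C i \<or> C i \<rightarrow>\<^bsub>\<Gamma>\<^esub> C' i)"

definition robber_move ::
    "('a, 'b) pre_digraph \<Rightarrow> enat \<Rightarrow> nat \<Rightarrow> (nat \<Rightarrow> 'a) \<Rightarrow> 'a \<Rightarrow> 'a \<Rightarrow> bool" where
  "robber_move \<Gamma> s k C u v \<longleftrightarrow>
     v = u \<or>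
     (\<exists>p. vpath p \<Gamma> \<and> hd p = u \<and> last p = v \<and> enat (vwalk_length p) \<le> s \<and>
          set p \<inter> C ` {..<k} = {})"

text \<open>A cop strategy \<open>\<sigma>\<close> maps the list of positions at which the robber has been so far
  (oldest first) to a placement of the cops: \<open>\<sigma> []\<close> is the initial placement, and
  \<open>\<sigma> [r\<^sub>0, \<dots>, r\<^sub>t]\<close> is the placement after the cops' move number \<open>t + 1\<close>. The earlier
  placements of the cops are determined by the same list.\<close>

definition cop_strategy ::
    "('a, 'b) pre_digraph \<Rightarrow> nat \<Rightarrow> ('a list \<Rightarrow> nat \<Rightarrow> 'a) \<Rightarrow> bool" where
  "cop_strategy \<Gamma> k \<sigma> \<longleftrightarrow>
     (\<forall>i<k. \<sigma> [] i \<in> verts \<Gamma>) \<and>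
     (\<forall>h v. set h \<subseteq> verts \<Gamma> \<and> v \<in> verts \<Gamma> \<longrightarrow> cop_move \<Gamma> k (\<sigma> h) (\<sigma> (h @ [v])))"

definition cops_at :: "('a list \<Rightarrow> nat \<Rightarrow> 'a) \<Rightarrow> (nat \<Rightarrow> 'a) \<Rightarrow> nat \<Rightarrow> nat \<Rightarrow> 'a" where
  "cops_at \<sigma> r t = \<sigma> (map r [0..<t])"

text \<open>Plays are continued forever. This is harmless: the robber may always stay where it is,
  so every play that ended with a capture extends to an infinite one.\<close>

definition robber_play ::
    "('a, 'b) pre_digraph \<Rightarrow> enat \<Rightarrow> nat \<Rightarrow> ('a list \<Rightarrow> nat \<Rightarrow> 'a) \<Rightarrow> (nat \<Rightarrow> 'a) \<Rightarrow> bool" where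
  "robber_play \<Gamma> s k \<sigma> r \<longleftrightarrow>
     r 0 \<in> verts \<Gamma> \<and>
     (\<forall>t. robber_move \<Gamma> s k (cops_at \<sigma> r (Suc t)) (r t) (r (Suc t)))"

text \<open>The robber at \<open>r t\<close> meets a cop either upon arriving there (for \<open>t = 0\<close>: when it
  chooses its initial vertex), or after the cops' next move.\<close>

definition captured :: "nat \<Rightarrow> ('a list \<Rightarrow> nat \<Rightarrow> 'a) \<Rightarrow> (nat \<Rightarrow> 'a) \<Rightarrow> bool" where
  "captured k \<sigma> r \<longleftrightarrow> (\<exists>t. \<exists>i<k. cops_at \<sigma> r t i = r t \<or> cops_at \<sigma> r (Suc t) i = r t)"

definition cops_win :: "('a, 'b) pre_digraph \<Rightarrow> enat \<Rightarrow> nat \<Rightarrow> bool" where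
  "cops_win \<Gamma> s k \<longleftrightarrow>
     (\<exists>\<sigma>. cop_strategy \<Gamma> k \<sigma> \<and> (\<forall>r. robber_play \<Gamma> s k \<sigma> r \<longrightarrow> captured k \<sigma> r))"

definition cop_number :: "enat \<Rightarrow> ('a, 'b) pre_digraph \<Rightarrow> nat" where
  "cop_number s \<Gamma> = (LEAST k. cops_win \<Gamma> s k)"

text \<open>On a finite digraph the minimum is attained: a cop on every vertex wins at once.\<close>

lemma cops_win_card_verts:
  assumes "finite (verts \<Gamma>)"
  shows "cops_win \<Gamma> s (card (verts \<Gamma>))"
proof -
  obtain f where f: "bij_betw f {..<card (verts \<Gamma>)} (verts \<Gamma>)"
    using ex_bij_betw_nat_finite[OF assms] by (auto simp: atLeast0LessThan)
  have "cop_strategy \<Gamma> (card (verts \<Gamma>)) (\<lambda>_. f)"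
    using bij_betwE[OF f] by (auto simp: cop_strategy_def cop_move_def)
  moreover have "captured (card (verts \<Gamma>)) (\<lambda>_. f) r"
    if "robber_play \<Gamma> s (card (verts \<Gamma>)) (\<lambda>_. f) r" for r
  proof -
    have "r 0 \<in> f ` {..<card (verts \<Gamma>)}"
      using that f by (simp add: robber_play_def bij_betw_def)
    then obtain i where "i < card (verts \<Gamma>)" "f i = r 0"
      by auto
    then show ?thesis
      unfolding captured_def cops_at_def by blast
  qed
  ultimately show ?thesis
    unfolding cops_win_def by blast
qed

lemma cops_win_cop_number:
  assumes "finite (verts \<Gamma>)"
  shows "cops_win \<Gamma> s (cop_number s \<Gamma>)"
  unfolding cop_number_def using cops_win_card_verts[OF assms] by (rule LeastI)

end

theory Submission
  imports Defs
begin

text \<open>A winning team on \<open>Cay(P, \<phi>(S) - {0})\<close> is lifted by replacing each of its cops with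
  \<open>|ker \<phi>|\<close> cops that together fill the fibre of \<open>\<phi>\<close> over its position: when the original cop
  traverses an arc \<open>\<phi>(g)\<close>, all cops of the fibre traverse \<open>g\<close> and fill the next fibre. Since whole
  fibres are guarded, a cop-free path of the robber projects to a cop-free walk, which contains a
  path that is not longer. So the projection of the robber takes part in a legal play, and as soon
  as it is caught, a cop of the corresponding fibre has caught the robber.\<close>

section \<open>Images of walks and paths under a vertex map\<close>

lemma vwalk_image:
  assumes "vwalk p \<Gamma>"
    and verts: "\<And>x. x \<in> verts \<Gamma> \<Longrightarrow> f x \<in> verts \<Delta>"
    and arcs: "\<And>x y. x \<rightarrow>\<^bsub>\<Gamma>\<^esub> y \<Longrightarrow> f x = f y \<or> f x \<rightarrow>\<^bsub>\<Delta>\<^esub> f y"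
  shows "\<exists>q. vwalk q \<Delta> \<and> hd q = f (hd p) \<and> last q = f (last p) \<and> set q \<subseteq> f ` set p"
  using assms(1)
proof (induction p rule: vwalk_arcs.induct)
  case 1
  then show ?case by (auto simp: vwalk_def)
next
  case (2 x)
  then show ?case by (intro exI[of _ "[f x]"]) (auto simp: vwalk_def verts)
next
  case (3 x y p)
  have "vwalk (y # p) \<Gamma>" "x \<in> verts \<Gamma>" and xy: "x \<rightarrow>\<^bsub>\<Gamma>\<^esub> y"
    using "3.prems" by (auto simp: vwalk_def)
  then obtain q where q: "vwalk q \<Delta>" "hd q = f y" "last q = f (last (y # p))"
      "set q \<subseteq> f ` set (y # p)"
    using "3.IH" by auto
  have "q \<noteq> []" using q(1) by auto
  \<comment> \<open>An arc contracted by \<open>f\<close> adds nothing to the image walk; any other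
    arc prepends \<open>f x\<close>.\<close>
  show ?case
  proof (cases "f x = f y")
    case True
    then show ?thesis using q by (intro exI[of _ q]) auto
  next
    case False
    then have "f x \<rightarrow>\<^bsub>\<Delta>\<^esub> f y" using arcs[OF xy] by simp
    then have "vwalk (f x # q) \<Delta>"
      using q verts[OF \<open>x \<in> verts \<Gamma>\<close>] by (intro vwalk_consI) auto
    then show ?thesis
      using q \<open>q \<noteq> []\<close> by (intro exI[of _ "f x # q"]) auto
  qed
qed

text \<open>The image walk may repeat vertices, so it is cut down to a path. The length bound comes
  from counting vertices: those of a path are distinct, and here they all lie in the image of
  \<open>set p\<close>.\<close>

lemma vpath_image:
  assumes "vpath p \<Gamma>"
    and "\<And>x. x \<in> verts \<Gamma> \<Longrightarrow> f x \<in> verts \<Delta>"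
    and "\<And>x y. x \<rightarrow>\<^bsub>\<Gamma>\<^esub> y \<Longrightarrow> f x = f y \<or> f x \<rightarrow>\<^bsub>\<Delta>\<^esub> f y"
  shows "\<exists>q. vpath q \<Delta> \<and> hd q = f (hd p) \<and> last q = f (last p) \<and> set q \<subseteq> f ` set p
    \<and> vwalk_length q \<le> vwalk_length p"
proof -
  obtain w where w: "vwalk w \<Delta>" "hd w = f (hd p)" "last w = f (last p)" "set w \<subseteq> f ` set p"
    using vwalk_image[of p \<Gamma> f \<Delta>] assms by blast
  let ?q = "vwalk_to_vpath w"
  have q: "vpath ?q \<Delta>" using w(1) by (rule vwalk_to_vpath_vpath)
  have sub: "set ?q \<subseteq> f ` set p"
    using w(4) vwalk_to_vpath_subset[of _ w] by blast
  have "length ?q = card (set ?q)"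
    using q by (simp add: vpath_def distinct_card)
  also have "\<dots> \<le> card (f ` set p)"
    using sub by (simp add: card_mono)
  also have "\<dots> \<le> length p"
    using card_image_le[of "set p" f] card_length[of p] by simp
  finally show ?thesis
    using q sub w by (intro exI[of _ ?q])
      (auto simp: vwalk_to_vpath_hd vwalk_to_vpath_last diff_le_mono)
qed

section \<open>Plays, captures and the lifting of strategies\<close>

lemma robber_move_in_verts:
  assumes "robber_move \<Gamma> s k C u v" "u \<in> verts \<Gamma>"
  shows "v \<in> verts \<Gamma>"
  using assms by (auto simp: robber_move_def vpath_def vwalk_def dest: last_in_set)

lemma robber_play_in_verts:
  assumes "robber_play \<Gamma> s k \<sigma> r"
  shows "r t \<in> verts \<Gamma>"
  using assms by (induction t) (auto simp: robber_play_def intro: robber_move_in_verts)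

text \<open>Written with images of index sets, capture matches the form of the fact
  \<open>guarded\<close> below and so transfers between the two games directly.\<close>

lemma captured_iff:
  fixes r :: "nat \<Rightarrow> 'a"
  shows "captured k \<sigma> r \<longleftrightarrow>
    (\<exists>t. r t \<in> cops_at \<sigma> r t ` {..<k} \<or> r t \<in> cops_at \<sigma> r (Suc t) ` {..<k})"
proof -
  have "x \<in> c ` {..<k} \<longleftrightarrow> (\<exists>i<k. c i = x)" for x and c :: "nat \<Rightarrow> 'a"
    by auto
  then show ?thesis unfolding captured_def by blast
qed

text \<open>\<open>fills e n y\<close> lets \<open>e\<close> repeat vertices; only the covering of
  the fibre counts. \<open>lift\<close> asks for every such \<open>e\<close>, not for one chosen
  well, because the position from which a team moves is the outcome of its earlier moves.\<close>

lemma cops_win_fibration: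
  fixes f :: "'a \<Rightarrow> 'b" and \<Gamma> :: "('a, 'c) pre_digraph" and \<Delta> :: "('b, 'd) pre_digraph"
  defines "fills e n y \<equiv> e ` {..<n} = {x \<in> verts \<Gamma>. f x = y}"
  assumes verts: "\<And>x. x \<in> verts \<Gamma> \<Longrightarrow> f x \<in> verts \<Delta>"
    and arcs: "\<And>x y. x \<rightarrow>\<^bsub>\<Gamma>\<^esub> y \<Longrightarrow> f x = f y \<or> f x \<rightarrow>\<^bsub>\<Delta>\<^esub> f y"
    and fill: "\<And>y. y \<in> verts \<Delta> \<Longrightarrow> \<exists>e. fills e n y"
    and lift: "\<And>y y' e. \<lbrakk>y \<rightarrow>\<^bsub>\<Delta>\<^esub> y'; fills e n y\<rbrakk>
      \<Longrightarrow> \<exists>e'. fills e' n y' \<and> (\<forall>l<n. e l \<rightarrow>\<^bsub>\<Gamma>\<^esub> e' l)"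
    and win: "cops_win \<Delta> s k"
  shows "cops_win \<Gamma> s (k * n)"
proof -
  obtain \<tau> where \<tau>: "cop_strategy \<Delta> k \<tau>"
    and \<tau>_wins: "\<And>r. robber_play \<Delta> s k \<tau> r \<Longrightarrow> captured k \<tau> r"
    using win by (auto simp: cops_win_def)
  \<comment> \<open>The history is stored newest first, so that the recursion is structural.\<close>
  define T where "T = rec_list (\<lambda>i. SOME e. fills e n (\<tau> [] i))
    (\<lambda>v h E i. SOME e. fills e n (\<tau> (map f (rev (v # h))) i) \<and>
      (\<forall>l<n. e l = E i l \<or> E i l \<rightarrow>\<^bsub>\<Gamma>\<^esub> e l))"
  have T_Nil: "T [] i = (SOME e. fills e n (\<tau> [] i))" for i
    by (simp add: T_def)
  have T_Cons: "T (v # h) i = (SOME e. fills e n (\<tau> (map f (rev (v # h))) i) \<and>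
      (\<forall>l<n. e l = T h i l \<or> T h i l \<rightarrow>\<^bsub>\<Gamma>\<^esub> e l))" for v h i
    by (simp add: T_def)
  have T_step: "fills (T (v # h) i) n (\<tau> (map f (rev (v # h))) i) \<and>
      (\<forall>l<n. T (v # h) i l = T h i l \<or> T h i l \<rightarrow>\<^bsub>\<Gamma>\<^esub> T (v # h) i l)"
    if "fills (T h i) n (\<tau> (map f (rev h)) i)" "set (v # h) \<subseteq> verts \<Gamma>" "i < k" for v h i
  proof -
    let ?y = "\<tau> (map f (rev h)) i" and ?y' = "\<tau> (map f (rev (v # h))) i"
    have "set (map f (rev h)) \<subseteq> verts \<Delta>" "f v \<in> verts \<Delta>"
      using that(2) verts by auto
    then have "cop_move \<Delta> k (\<tau> (map f (rev h))) (\<tau> (map f (rev h) @ [f v]))"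
      using \<tau> unfolding cop_strategy_def by blast
    then have "?y' = ?y \<or> ?y \<rightarrow>\<^bsub>\<Delta>\<^esub> ?y'"
      using \<open>i < k\<close> by (simp add: cop_move_def)
    \<comment> \<open>If cop \<open>i\<close> stays, \<open>T h i\<close> is itself a witness;
      otherwise \<open>lift\<close> supplies one. So the \<open>SOME\<close> in
      \<open>T_Cons\<close> has something to choose.\<close>
    then have "\<exists>e. fills e n ?y' \<and> (\<forall>l<n. e l = T h i l \<or> T h i l \<rightarrow>\<^bsub>\<Gamma>\<^esub> e l)"
      using that(1) lift by metis
    then show ?thesis
      unfolding T_Cons by (rule someI_ex)
  qed
  have T_fills: "fills (T h i) n (\<tau> (map f (rev h)) i)"
    if "set h \<subseteq> verts \<Gamma>" "i < k" for h i
    using that(1)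
  proof (induction h)
    case Nil
    have "\<tau> [] i \<in> verts \<Delta>"
      using \<tau> \<open>i < k\<close> by (simp add: cop_strategy_def)
    then show ?case
      using someI_ex[OF fill] by (simp add: T_Nil)
  next
    case (Cons v h)
    then show ?case using T_step[of h i v] \<open>i < k\<close> by simp
  qed
  \<comment> \<open>Cop \<open>j\<close> is member \<open>j mod n\<close> of the team that replaces
    cop \<open>j div n\<close>. Strategies receive histories oldest first, hence
    \<open>rev\<close>.\<close>
  define \<sigma> where "\<sigma> h j = T (rev h) (j div n) (j mod n)" for h j
  \<comment> \<open>The case \<open>n = 0\<close> is vacuous, as then no \<open>j < k * n\<close>
    exists.\<close>
  have div_mod: "j div n < k" "j mod n < n" if "j < k * n" for j
    using that by (auto simp: less_mult_imp_div_less intro!: mod_less_divisor gr0I)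
  have "cop_strategy \<Gamma> (k * n) \<sigma>"
    unfolding cop_strategy_def cop_move_def
  proof (intro conjI allI impI)
    fix j assume "j < k * n"
    then have "T [] (j div n) (j mod n) \<in> verts \<Gamma>"
      using T_fills[of "[]" "j div n"] div_mod[of j] by (auto simp: fills_def)
    then show "\<sigma> [] j \<in> verts \<Gamma>" by (simp add: \<sigma>_def)
  next
    fix h v j assume "set h \<subseteq> verts \<Gamma> \<and> v \<in> verts \<Gamma>" "j < k * n"
    then show "\<sigma> (h @ [v]) j = \<sigma> h j \<or> \<sigma> h j \<rightarrow>\<^bsub>\<Gamma>\<^esub> \<sigma> (h @ [v]) j"
      using T_step[of "rev h" "j div n" v] T_fills[of "rev h" "j div n"] div_mod[of j]
      by (simp add: \<sigma>_def)
  qed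
  moreover have "captured (k * n) \<sigma> r" if play: "robber_play \<Gamma> s (k * n) \<sigma> r" for r
  proof -
    have r: "r t \<in> verts \<Gamma>" for t
      using play by (rule robber_play_in_verts)
    \<comment> \<open>Stated for any vertex \<open>x\<close> and not only for the robber's position,
      so that it serves both for the vertices of the robber's path and for the capture.\<close>
    have guarded: "x \<in> cops_at \<sigma> r t ` {..<k * n}"
      if x: "x \<in> verts \<Gamma>" "f x \<in> cops_at \<tau> (f \<circ> r) t ` {..<k}" for x t
    proof -
      obtain i where i: "i < k" "f x = cops_at \<tau> (f \<circ> r) t i" using x(2) by auto
      let ?h = "rev (map r [0..<t])"
      have "set ?h \<subseteq> verts \<Gamma>" using r by auto
      from T_fills[OF this i(1)] have "x \<in> T ?h i ` {..<n}"
        using x(1) i(2) by (simp add: fills_def cops_at_def)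
      then obtain l where l: "l < n" "x = T ?h i l" by auto
      have "i * n + l < k * n"
        using i(1) l(1) mult_le_mono1[of "Suc i" k n] by simp
      moreover have "x = cops_at \<sigma> r t (i * n + l)"
        using l by (simp add: cops_at_def \<sigma>_def)
      ultimately show ?thesis by blast
    qed
    have "robber_play \<Delta> s k \<tau> (f \<circ> r)"
      unfolding robber_play_def
    proof (intro conjI allI)
      show "(f \<circ> r) 0 \<in> verts \<Delta>" using r verts by simp
    next
      fix t
      have "robber_move \<Gamma> s (k * n) (cops_at \<sigma> r (Suc t)) (r t) (r (Suc t))"
        using play by (simp add: robber_play_def)
      then consider "r (Suc t) = r t"
        | p where "vpath p \<Gamma>" "hd p = r t" "last p = r (Suc t)" "enat (vwalk_length p) \<le> s"
            "set p \<inter> cops_at \<sigma> r (Suc t) ` {..<k * n} = {}"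
        unfolding robber_move_def by blast
      then show "robber_move \<Delta> s k (cops_at \<tau> (f \<circ> r) (Suc t)) ((f \<circ> r) t) ((f \<circ> r) (Suc t))"
      proof cases
        case 1
        then show ?thesis by (simp add: robber_move_def)
      next
        case (2 p)
        obtain q where q: "vpath q \<Delta>" "hd q = f (hd p)" "last q = f (last p)"
            "set q \<subseteq> f ` set p" "vwalk_length q \<le> vwalk_length p"
          using vpath_image[of p \<Gamma> f \<Delta>, OF 2(1) verts arcs] by blast
        have "set p \<subseteq> verts \<Gamma>" using 2(1) by auto
        \<comment> \<open>A cop of \<open>\<tau>\<close> on \<open>q\<close> would put a cop of
          \<open>\<sigma>\<close> on a vertex of \<open>p\<close>.\<close>
        have "set q \<inter> cops_at \<tau> (f \<circ> r) (Suc t) ` {..<k} = {}"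
        proof (rule equals0I, elim IntE)
          fix y assume y: "y \<in> set q" "y \<in> cops_at \<tau> (f \<circ> r) (Suc t) ` {..<k}"
          obtain x where "x \<in> set p" "y = f x"
            using y(1) q(4) by blast
          then show False
            using y(2) guarded[of x "Suc t"] 2(5) \<open>set p \<subseteq> verts \<Gamma>\<close> by auto
        qed
        moreover have "enat (vwalk_length q) \<le> s"
          using q(5) 2(4) by (meson enat_ord_simps(1) order_trans)
        ultimately show ?thesis
          using q(1-3) 2(2,3) by (auto simp: robber_move_def intro!: disjI2 exI[of _ q])
      qed
    qed
    then have "captured k \<tau> (f \<circ> r)"
      by (rule \<tau>_wins)
    \<comment> \<open>\<open>guarded\<close> is applied with the cops' time \<open>t\<close> or
      \<open>Suc t\<close>, according to how the projected robber at time \<open>t\<close> is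
      caught.\<close>
    then show ?thesis
      using guarded[OF r] unfolding captured_iff comp_apply by blast
  qed
  ultimately show ?thesis
    unfolding cops_win_def by blast
qed

section \<open>Cayley digraphs and translations\<close>

lemma verts_Cay [simp]: "pverts (Cay G S) = carrier G"
  by (simp add: Cay_def)

lemma arcs_Cay [simp]:
  "(x, y) \<in> parcs (Cay G S) \<longleftrightarrow> x \<in> carrier G \<and> (\<exists>g\<in>S. y = x \<otimes>\<^bsub>G\<^esub> g)"
  by (auto simp: Cay_def)

text \<open>The fibres of \<open>\<phi>\<close> are the right cosets of the kernel, so each has
  \<open>card (kernel G P \<phi>)\<close> elements; arcs are right translations, which permute these
  cosets.\<close>

lemma cops_win_Cay_epi:
  assumes "group G" "finite (carrier G)" "S \<subseteq> carrier G" "group P" "\<phi> \<in> epi G P"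
    and "cops_win (with_proj (Cay P (\<phi> ` S - {\<one>\<^bsub>P\<^esub>}))) s k"
  shows "cops_win (with_proj (Cay G S)) s (k * card (kernel G P \<phi>))"
proof (rule cops_win_fibration[where f = \<phi>, OF _ _ _ _ assms(6)])
  interpret group_hom G P \<phi>
    using assms by (simp add: group_hom_def group_hom_axioms_def epi_def)
  let ?n = "card (kernel G P \<phi>)"
  have surj: "\<phi> ` carrier G = carrier P"
    using assms(5) by (simp add: epi_def)
  show "\<phi> x \<in> verts (with_proj (Cay P (\<phi> ` S - {\<one>\<^bsub>P\<^esub>})))"
    if "x \<in> verts (with_proj (Cay G S))" for x
    using that by simp
  \<comment> \<open>A generator in the kernel gives an arc that \<open>\<phi>\<close> contracts; any
    other maps to a generator of the quotient digraph.\<close>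
  show "\<phi> x = \<phi> y \<or> \<phi> x \<rightarrow>\<^bsub>with_proj (Cay P (\<phi> ` S - {\<one>\<^bsub>P\<^esub>}))\<^esub> \<phi> y"
    if "x \<rightarrow>\<^bsub>with_proj (Cay G S)\<^esub> y" for x y
    using that assms(3) by (auto simp: subset_iff)
  \<comment> \<open>With \<open>y\<close> the identity this turns the kernel into the fibre over
    \<open>\<phi> g\<close>; in general it moves a fibre along an arc. That the whole target is
    reached is seen by translating back with the inverse of \<open>g\<close>.\<close>
  have shift: "(\<lambda>x. x \<otimes>\<^bsub>G\<^esub> g) ` {x \<in> carrier G. \<phi> x = y} = {x \<in> carrier G. \<phi> x = y \<otimes>\<^bsub>P\<^esub> \<phi> g}"
    if "g \<in> carrier G" "y \<in> carrier P" for g y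
  proof -
    have "x \<in> (\<lambda>x. x \<otimes>\<^bsub>G\<^esub> g) ` {x \<in> carrier G. \<phi> x = y}"
      if "x \<in> carrier G" "\<phi> x = y \<otimes>\<^bsub>P\<^esub> \<phi> g" for x
      using that \<open>g \<in> carrier G\<close> \<open>y \<in> carrier P\<close>
      by (intro image_eqI[of _ _ "x \<otimes>\<^bsub>G\<^esub> inv\<^bsub>G\<^esub> g"]) (auto simp: G.m_assoc H.m_assoc)
    then show ?thesis using that by auto
  qed
  show "\<exists>e. e ` {..<?n} = {x \<in> verts (with_proj (Cay G S)). \<phi> x = y}"
    if y: "y \<in> verts (with_proj (Cay P (\<phi> ` S - {\<one>\<^bsub>P\<^esub>})))" for y
  proof -
    have "y \<in> \<phi> ` carrier G" using y surj by simp
    \<comment> \<open>Any preimage \<open>g\<close> of \<open>y\<close> translates an enumeration of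
      the kernel into one of the fibre over \<open>y\<close>.\<close>
    then obtain g where g: "g \<in> carrier G" "\<phi> g = y" by blast
    have "finite (kernel G P \<phi>)" using assms(2) by (simp add: kernel_def)
    then obtain e where e: "e ` {..<?n} = kernel G P \<phi>"
      using ex_bij_betw_nat_finite[of "kernel G P \<phi>"]
      by (auto simp: atLeast0LessThan bij_betw_def)
    have "(\<lambda>l. e l \<otimes>\<^bsub>G\<^esub> g) ` {..<?n} = (\<lambda>x. x \<otimes>\<^bsub>G\<^esub> g) ` kernel G P \<phi>"
      using arg_cong[OF e, of "(`) (\<lambda>x. x \<otimes>\<^bsub>G\<^esub> g)"] by (simp only: image_image)
    also have "\<dots> = {x \<in> carrier G. \<phi> x = y}"
      using shift[of g "\<one>\<^bsub>P\<^esub>"] g by (auto simp: kernel_def)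
    finally show ?thesis by auto
  qed
  show "\<exists>e'. e' ` {..<?n} = {x \<in> verts (with_proj (Cay G S)). \<phi> x = y'} \<and>
      (\<forall>l<?n. e l \<rightarrow>\<^bsub>with_proj (Cay G S)\<^esub> e' l)"
    if y: "y \<rightarrow>\<^bsub>with_proj (Cay P (\<phi> ` S - {\<one>\<^bsub>P\<^esub>}))\<^esub> y'"
      and e: "e ` {..<?n} = {x \<in> verts (with_proj (Cay G S)). \<phi> x = y}" for y y' e
  proof -
    \<comment> \<open>Several generators may have the same image; one \<open>g\<close> is fixed for
      the whole team, so that it moves by a single translation and covers the next fibre.\<close>
    obtain g where g: "g \<in> S" "y \<in> carrier P" "y' = y \<otimes>\<^bsub>P\<^esub> \<phi> g"
      using y by auto
    have "(\<lambda>l. e l \<otimes>\<^bsub>G\<^esub> g) ` {..<?n} = (\<lambda>x. x \<otimes>\<^bsub>G\<^esub> g) ` {x \<in> carrier G. \<phi> x = y}"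
      using arg_cong[OF e, of "(`) (\<lambda>x. x \<otimes>\<^bsub>G\<^esub> g)"]
      by (simp only: image_image with_proj_simps verts_Cay)
    also have "\<dots> = {x \<in> carrier G. \<phi> x = y'}"
      using shift[of g y] g assms(3) by auto
    finally have "(\<lambda>l. e l \<otimes>\<^bsub>G\<^esub> g) ` {..<?n} = {x \<in> carrier G. \<phi> x = y'}" .
    moreover have "\<forall>l<?n. e l \<in> carrier G"
      using e by auto
    ultimately show ?thesis
      using g(1) by (intro exI[of _ "\<lambda>l. e l \<otimes>\<^bsub>G\<^esub> g"]) auto
  qed
qed

theorem proposition4p1:
  fixes G :: "('a, 'm) monoid_scheme" and P :: "('b, 'n) monoid_scheme"
    and S :: "'a set" and \<phi> :: "'a \<Rightarrow> 'b"
  assumes "comm_group G" and "finite (carrier G)" and "order G \<ge> 2"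
    and "S \<subseteq> carrier G - {\<one>\<^bsub>G\<^esub>}"
    and "strongly_connected (with_proj (Cay G S))"
    and "group P" and "finite (carrier P)"
    and "\<phi> \<in> epi G P"
  shows "cop_number \<infinity> (with_proj (Cay G S))
           \<le> card (kernel G P \<phi>) * cop_number \<infinity> (with_proj (Cay P (\<phi> ` S - {\<one>\<^bsub>P\<^esub>})))
       \<and> (\<forall>s::nat. s \<ge> 1 \<longrightarrow>
            cop_number (enat s) (with_proj (Cay G S))
              \<le> card (kernel G P \<phi>) * cop_number (enat s) (with_proj (Cay P (\<phi> ` S - {\<one>\<^bsub>P\<^esub>}))))"
proof -
  \<comment> \<open>Here \<open>s\<close> ranges over \<open>enat\<close>, which treats the infinite
    and the finite speeds at once.\<close>
  have "cop_number s (with_proj (Cay G S))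
      \<le> card (kernel G P \<phi>) * cop_number s (with_proj (Cay P (\<phi> ` S - {\<one>\<^bsub>P\<^esub>})))" for s
  proof -
    have "group G" "S \<subseteq> carrier G"
      using assms(1,4) by (auto simp: comm_group_def)
    \<comment> \<open>Since \<open>P\<close> is finite, its cop number is attained by a winning
      team, and the lifted team bounds the least number for \<open>G\<close> from above.\<close>
    moreover have "cops_win (with_proj (Cay P (\<phi> ` S - {\<one>\<^bsub>P\<^esub>}))) s
        (cop_number s (with_proj (Cay P (\<phi> ` S - {\<one>\<^bsub>P\<^esub>}))))"
      using assms(7) by (intro cops_win_cop_number) simp
    ultimately have "cops_win (with_proj (Cay G S)) s
        (cop_number s (with_proj (Cay P (\<phi> ` S - {\<one>\<^bsub>P\<^esub>}))) * card (kernel G P \<phi>))"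
      using assms(2,6,8) by (intro cops_win_Cay_epi)
    then show ?thesis
      by (subst mult.commute) (simp add: cop_number_def[of _ "with_proj (Cay G S)"] Least_le)
  qed
  then show ?thesis by blast
qed

end
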